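(* Let $\mathcal X=\{x\in\mathbb R^d: Ax=b,\ x\ge0\}$ be bounded and nonempty and let $\mathcal C\subset\mathbb R^d$ be nonempty. For every sufficiently small $\epsilon>0$ (depending on $A,b,\mathcal C$), the algorithm described in the context, run on input $(\mathcal X,\mathcal C)$ with constant $\epsilon$, terminates with probability $1$ after $\dim \mathrm{dir}(\mathcal X^\star(\mathcal C))\le d$ steps (iterations of the while loop) and outputs a basis of $\mathrm{dir}(\mathcal X^\star(\mathcal C))$.
   Context: Here $A\in\mathbb R^{m\times d}$, $b\in\mathbb R^m$. The set of reachable solutions is $\mathcal X^\star(\mathcal C)=\bigcup_{c\in\mathcal C}\arg\min_{x\in\mathcal X}c^\top x$, and $\mathrm{dir}(\mathcal X^\star(\mathcal C))=\mathrm{span}\{x_1-x_2: x_1,x_2\in\mathcal X^\star(\mathcal C)\}$. For a subspace $G$, $\mathrm{proj}_G$ denotes orthogonal projection onto $G$; the span of the empty set is $\{0\}$. Algorithm. Input: $\mathcal X=\{x\ge0: Ax=b\}$ and $\mathcal C$. 1. Initialize $\mathcal D=\varnothing$. Choose $x_0\in\arg\min_{x\in\mathcal X}c_0^\top x$ for some $c_0\in\mathcal C$. Sample a standard Gaussian vector $\alpha\sim\mathcal N(0,I_d)$. 2. While at least one of the two optimization problems (minimization, respectively maximization) $$\min/\max\ \ \alpha^\top\mathrm{proj}_{(\mathrm{span}\,\mathcal D)^\perp}(x_0-x)$$ over variables $x\in\mathbb R^d,\lambda\in\mathbb R^m,s\in\mathbb R^d,c\in\mathbb R^d,\tau\in\{0,1\}^d$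 subject to $$x\ge0,\quad s\ge0,\quad c\in\mathcal C,\quad Ax=b,\quad A^\top\lambda+s=c,\quad 1-\epsilon s_i\ge\tau_i\ge\epsilon x_i\ \ \forall i\in\{1,\dots,d\},$$ has an optimal solution with non-zero optimal value: let $x^\star$ be the $x$-component of such an optimal solution, set $\mathcal D\leftarrow\mathcal D\cup\{x^\star-x_0\}$, and resample $\alpha\sim\mathcal N(0,I_d)$ independently of the past. 3. Return $\mathcal D$. *)

theory Defs
  imports "HOL-Probability.Probability"
begin

definition polyhedron_eq :: "real^'d^'m \<Rightarrow> real^'m \<Rightarrow> (real^'d) set" where
  "polyhedron_eq A b = {x. A *v x = b \<and> (\<forall>i. 0 \<le> x $ i)}"

definition lp_argmin :: "(real^'d) set \<Rightarrow> real^'d \<Rightarrow> (real^'d) set" where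
  "lp_argmin X c = {x. is_arg_min (\<lambda>y. c \<bullet> y) (\<lambda>y. y \<in> X) x}"

definition reachable_solutions :: "(real^'d) set \<Rightarrow> (real^'d) set \<Rightarrow> (real^'d) set" where
  "reachable_solutions X C = (\<Union>c\<in>C. lp_argmin X c)"

definition dir :: "(real^'d) set \<Rightarrow> (real^'d) set" where
  "dir S = span {x - y | x y. x \<in> S \<and> y \<in> S}"

definition orth_proj :: "(real^'d) set \<Rightarrow> real^'d \<Rightarrow> real^'d" where
  "orth_proj G x = (THE p. p \<in> G \<and> x - p \<in> orthogonal_comp G)"

definition is_basis_of :: "(real^'d) set \<Rightarrow> (real^'d) set \<Rightarrow> bool" where
  "is_basis_of B G \<longleftrightarrow> independent B \<and> span B = G"

definition std_gaussian :: "(real^'d) measure" where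
  "std_gaussian = density lborel (\<lambda>x. ennreal (\<Prod>i\<in>UNIV. std_normal_density (x $ i)))"

lemma prob_space_std_gaussian: "prob_space (std_gaussian :: (real^'d) measure)"
proof
  define f :: "real^'d \<Rightarrow> real \<Rightarrow> real" where "f = (\<lambda>b. std_normal_density)"
  have B: "(Basis :: (real^'d) set) = (\<lambda>i. axis i 1) ` UNIV"
    by (auto simp: Basis_vec_def)
  have inj: "inj (\<lambda>i::'d. axis i (1::real))"
    by (auto simp: inj_def axis_eq_axis)
  have eq: "ennreal (\<Prod>i\<in>UNIV. std_normal_density (x $ i)) =
      (\<Prod>b\<in>Basis. ennreal (f b (x \<bullet> b)))" for x :: "real^'d"
    unfolding B f_def
    by (subst prod.reindex[OF inj]) (simp add: prod_ennreal inner_axis)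
  have "(\<integral>\<^sup>+x. ennreal (std_normal_density x) \<partial>lborel) = 1"
    using prob_space.emeasure_space_1[OF prob_space_normal_density[of 1 0]]
    by (simp add: emeasure_density)
  then have "(\<integral>\<^sup>+(x::real^'d). (\<Prod>b\<in>Basis. ennreal (f b (x \<bullet> b))) \<partial>lborel) = 1"
    by (subst nn_integral_lborel_prod) (simp_all add: f_def)
  then show "emeasure (std_gaussian :: (real^'d) measure)
      (space (std_gaussian :: (real^'d) measure)) = 1"
    unfolding std_gaussian_def by (simp add: emeasure_density eq f_def)
qed

(* Variables (x, lam, s, c, tau) of the mixed-binary programs. *)
type_synonym ('d, 'm) prog_vars =
  "(real^'d) \<times> (real^'m) \<times> (real^'d) \<times> (real^'d) \<times> (real^'d)"

definition prog_feasible ::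
  "real^'d^'m \<Rightarrow> real^'m \<Rightarrow> (real^'d) set \<Rightarrow> real \<Rightarrow> ('d, 'm) prog_vars \<Rightarrow> bool" where
  "prog_feasible A b C eps = (\<lambda>(x, lam, s, c, tau).
     (\<forall>i. 0 \<le> x $ i) \<and> (\<forall>i. 0 \<le> s $ i) \<and> c \<in> C \<and> A *v x = b \<and>
     transpose A *v lam + s = c \<and>
     (\<forall>i. tau $ i \<in> {0, 1}) \<and>
     (\<forall>i. 1 - eps * s $ i \<ge> tau $ i \<and> tau $ i \<ge> eps * x $ i))"

definition prog_objective ::
  "real^'d \<Rightarrow> real^'d \<Rightarrow> (real^'d) set \<Rightarrow> ('d, 'm) prog_vars \<Rightarrow> real" where
  "prog_objective x0 \<alpha> D = (\<lambda>(x, lam, s, c, tau).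
     \<alpha> \<bullet> orth_proj (orthogonal_comp (span D)) (x0 - x))"

definition improving_solution ::
  "real^'d^'m \<Rightarrow> real^'m \<Rightarrow> (real^'d) set \<Rightarrow> real \<Rightarrow> real^'d \<Rightarrow> real^'d \<Rightarrow> (real^'d) set \<Rightarrow>
   ('d, 'm) prog_vars \<Rightarrow> bool" where
  "improving_solution A b C eps x0 \<alpha> D v \<longleftrightarrow>
     (is_arg_min (prog_objective x0 \<alpha> D) (prog_feasible A b C eps) v \<or>
      is_arg_max (prog_objective x0 \<alpha> D) (prog_feasible A b C eps) v) \<and>
     prog_objective x0 \<alpha> D v \<noteq> 0"

(* One pass through the loop. The choice among improving solutions is left open,
   so this is a relation between the values of the set D before and after the pass. *)
definition loop_step ::
  "real^'d^'m \<Rightarrow> real^'m \<Rightarrow> (real^'d) set \<Rightarrow> real \<Rightarrow> real^'d \<Rightarrow> real^'d \<Rightarrow>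
   (real^'d) set \<Rightarrow> (real^'d) set \<Rightarrow> bool" where
  "loop_step A b C eps x0 \<alpha> D D' \<longleftrightarrow>
     (\<exists>v. improving_solution A b C eps x0 \<alpha> D v \<and> D' = D \<union> {fst v - x0})"

(* a k is the Gaussian vector in use once k passes through the loop are completed:
   a 0 is the initial sample, a (Suc k) the resample at the end of the pass that used a k. *)
inductive after_steps ::
  "real^'d^'m \<Rightarrow> real^'m \<Rightarrow> (real^'d) set \<Rightarrow> real \<Rightarrow> real^'d \<Rightarrow> (nat \<Rightarrow> real^'d) \<Rightarrow>
   nat \<Rightarrow> (real^'d) set \<Rightarrow> bool"
  for A b C eps x0 a where
  init: "after_steps A b C eps x0 a 0 {}"
| step: "after_steps A b C eps x0 a k D \<Longrightarrow> loop_step A b C eps x0 (a k) D D' \<Longrightarrow>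
         after_steps A b C eps x0 a (Suc k) D'"

definition returns_after ::
  "real^'d^'m \<Rightarrow> real^'m \<Rightarrow> (real^'d) set \<Rightarrow> real \<Rightarrow> real^'d \<Rightarrow> (nat \<Rightarrow> real^'d) \<Rightarrow>
   nat \<Rightarrow> (real^'d) set \<Rightarrow> bool" where
  "returns_after A b C eps x0 a n D \<longleftrightarrow>
     after_steps A b C eps x0 a n D \<and> \<not> (\<exists>v. improving_solution A b C eps x0 (a n) D v)"

definition runs_forever ::
  "real^'d^'m \<Rightarrow> real^'m \<Rightarrow> (real^'d) set \<Rightarrow> real \<Rightarrow> real^'d \<Rightarrow> (nat \<Rightarrow> real^'d) \<Rightarrow>
   (nat \<Rightarrow> (real^'d) set) \<Rightarrow> bool" where
  "runs_forever A b C eps x0 a Ds \<longleftrightarrow>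
     Ds 0 = {} \<and> (\<forall>k. loop_step A b C eps x0 (a k) (Ds k) (Ds (Suc k)))"

end

theory Submission
  imports Defs
begin

text \<open>
  The set \<open>S\<close> of reachable solutions is a union of finitely many faces of the bounded polyhedron, so
  it is contained in the convex hull of a finite subset \<open>V\<close>, to which we add \<open>x0\<close>. Choosing one dual
  solution per face bounds the dual slacks uniformly although \<open>C\<close> may be unbounded; hence for small
  \<open>eps\<close> the binary constraints express exactly complementary slackness, and \<open>S\<close> is the projection of
  the feasible set of the programs.

  The choices made by the loop may depend on all Gaussian vectors, so conditioning on the past is
  avoided: almost surely every sample misses the finitely many hyperplanes orthogonal to a nonzero
  projection of some \<open>v - w\<close>, with \<open>v, w \<in> V\<close>, along the span of a set of such differences. For such
  samples every optimum has the same projection as a point of \<open>V\<close>, so the span of \<open>D\<close> always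
  stays within this finite family, whatever optimum is chosen. An optimum with nonzero value
  enlarges the span by one dimension, and if both optimal values are zero, the span contains
  \<open>V - x0\<close>, hence \<open>S - x0\<close>.
\<close>

section \<open>Orthogonal projections onto subspaces\<close>

lemma orth_proj_unique:
  assumes "subspace H" and "p \<in> H" "x - p \<in> orthogonal_comp H"
  shows "orth_proj H x = p"
  unfolding orth_proj_def
proof (rule the_equality)
  show "p \<in> H \<and> x - p \<in> orthogonal_comp H"
    using assms by simp
  fix q assume q: "q \<in> H \<and> x - q \<in> orthogonal_comp H"
  have "p - q \<in> H"
    using assms q by (simp add: subspace_diff)
  moreover have "(x - q) - (x - p) \<in> orthogonal_comp H"
    using assms q by (blast intro: subspace_diff[OF subspace_orthogonal_comp])
  ultimately have "(p - q) \<bullet> (p - q) = 0"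
    by (simp add: orthogonal_comp_def orthogonal_def)
  then show "q = p" by simp
qed

lemma orth_proj_in:
  assumes "subspace H"
  shows "orth_proj H x \<in> H" "x - orth_proj H x \<in> orthogonal_comp H"
proof -
  obtain y z where yz: "y \<in> span H" "\<And>w. w \<in> span H \<Longrightarrow> orthogonal z w" "x = y + z"
    by (rule orthogonal_subspace_decomp_exists[of H x]) blast
  have "span H = H"
    using assms by (simp add: span_eq_iff)
  with yz have *: "y \<in> H" "x - y \<in> orthogonal_comp H"
    by (auto simp: orthogonal_comp_def orthogonal_commute)
  from orth_proj_unique[OF assms this] *
  show "orth_proj H x \<in> H" "x - orth_proj H x \<in> orthogonal_comp H"
    by simp_all
qed

lemma linear_orth_proj:
  assumes "subspace H"
  shows "linear (orth_proj H)"
proof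
  note in_comp = orth_proj_in[OF assms]
  fix x y and r :: real
  have "x + y - (orth_proj H x + orth_proj H y)
      = (x - orth_proj H x) + (y - orth_proj H y)" by simp
  also have "\<dots> \<in> orthogonal_comp H"
    by (intro subspace_add[OF subspace_orthogonal_comp] in_comp)
  finally show "orth_proj H (x + y) = orth_proj H x + orth_proj H y"
    by (intro orth_proj_unique assms subspace_add in_comp)
  have "r *\<^sub>R x - r *\<^sub>R orth_proj H x = r *\<^sub>R (x - orth_proj H x)"
    by (simp add: scaleR_right_diff_distrib)
  also have "\<dots> \<in> orthogonal_comp H"
    by (intro subspace_scale[OF subspace_orthogonal_comp] in_comp)
  finally show "orth_proj H (r *\<^sub>R x) = r *\<^sub>R orth_proj H x"
    by (intro orth_proj_unique assms subspace_scale in_comp)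
qed

text \<open>The kernel of the projection is the double orthogonal complement of \<open>G\<close>,
  which is \<open>G\<close> itself in finite dimension.\<close>

lemma orth_proj_orthogonal_comp_eq_0_iff:
  assumes "subspace G"
  shows "orth_proj (orthogonal_comp G) x = 0 \<longleftrightarrow> x \<in> G"
proof
  assume "orth_proj (orthogonal_comp G) x = 0"
  then show "x \<in> G"
    using orth_proj_in(2)[OF subspace_orthogonal_comp, of x G] orthogonal_comp_self[OF assms]
    by simp
next
  assume "x \<in> G"
  then show "orth_proj (orthogonal_comp G) x = 0"
    using orthogonal_comp_self[OF assms]
    by (intro orth_proj_unique subspace_orthogonal_comp subspace_0) auto
qed

section \<open>Generic Gaussian vectors and optima over convex hulls\<close>

text \<open>Hyperplanes are Lebesgue null, and the Gaussian measure has a density.\<close>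

lemma AE_std_gaussian_inner_neq_0:
  fixes w :: "real^'d"
  assumes "w \<noteq> 0"
  shows "AE \<alpha> in std_gaussian. \<alpha> \<bullet> w \<noteq> 0"
proof -
  have "{\<alpha>. w \<bullet> \<alpha> = 0} \<in> null_sets (lebesgue :: (real^'d) measure)"
    using negligible_hyperplane[of w 0] assms by (simp add: negligible_iff_null_sets)
  then have "{\<alpha>. w \<bullet> \<alpha> = 0} \<in> null_sets (lborel :: (real^'d) measure)"
    by (subst (asm) null_sets_completion_iff) (simp_all add: closed_hyperplane borel_closed)
  then have "AE \<alpha> in lborel. \<alpha> \<bullet> w \<noteq> 0"
    by (rule AE_I') (auto simp: inner_commute)
  then show ?thesis
    unfolding std_gaussian_def by (subst AE_density) auto
qed

text \<open>\<open>B\<close> ranges over all subsets of \<open>T\<close>, not over states of the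
  loop, so the condition is fixed before any choice is made. Each pair \<open>B\<close>,
  \<open>d\<close> excludes one hyperplane, because the projection of \<open>d\<close> vanishes only
  on \<open>span B\<close>.\<close>

definition generic_for :: "(real^'d) set \<Rightarrow> real^'d \<Rightarrow> bool" where
  "generic_for T \<alpha> \<longleftrightarrow> (\<forall>B\<subseteq>T. \<forall>d\<in>T. d \<notin> span B \<longrightarrow>
     \<alpha> \<bullet> orth_proj (orthogonal_comp (span B)) d \<noteq> 0)"

lemma AE_generic_for:
  assumes "finite T"
  shows "AE \<alpha> in std_gaussian. generic_for T \<alpha>"
proof -
  have "AE \<alpha> in std_gaussian. \<forall>B\<in>Pow T. \<forall>d\<in>T. d \<notin> span B \<longrightarrow>
      \<alpha> \<bullet> orth_proj (orthogonal_comp (span B)) d \<noteq> 0"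
  proof (intro AE_finite_allI finite_Pow_iff[THEN iffD2] assms)
    fix B d
    show "AE \<alpha> in std_gaussian. d \<notin> span B \<longrightarrow>
        \<alpha> \<bullet> orth_proj (orthogonal_comp (span B)) d \<noteq> 0"
      using AE_std_gaussian_inner_neq_0[of "orth_proj (orthogonal_comp (span B)) d"]
      by (cases "d \<in> span B") (simp_all add: orth_proj_orthogonal_comp_eq_0_iff)
  qed
  then show ?thesis
    by (rule eventually_mono) (auto simp: generic_for_def)
qed

text \<open>Write \<open>x\<close> as a convex combination of \<open>V\<close>. The weighted sum of
  the nonnegative gaps to the minimal value is zero, so every point of positive weight attains that
  value. By \<open>gen\<close> these points share one image under \<open>P\<close>, and the
  combination returns it.\<close>

lemma minimizer_over_hull_same_image:
  fixes P :: "'a::real_vector \<Rightarrow> 'b::real_inner"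
  assumes "finite V" "x \<in> convex hull V" and P: "linear P"
    and min: "\<And>v. v \<in> V \<Longrightarrow> \<alpha> \<bullet> P x \<le> \<alpha> \<bullet> P v"
    and gen: "\<And>v w. v \<in> V \<Longrightarrow> w \<in> V \<Longrightarrow> \<alpha> \<bullet> P v = \<alpha> \<bullet> P w \<Longrightarrow> P v = P w"
  shows "\<exists>v\<in>V. P x = P v"
proof -
  obtain u where u: "\<And>v. v \<in> V \<Longrightarrow> 0 \<le> u v" "sum u V = 1" "(\<Sum>v\<in>V. u v *\<^sub>R v) = x"
    using assms(1,2) by (auto simp: convex_hull_finite)
  have Px: "P x = (\<Sum>v\<in>V. u v *\<^sub>R P v)"
    using u(3) P by (auto simp: linear_sum linear_scale)
  have "(\<Sum>v\<in>V. u v * (\<alpha> \<bullet> P v - \<alpha> \<bullet> P x)) =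
      \<alpha> \<bullet> (\<Sum>v\<in>V. u v *\<^sub>R P v) - (\<Sum>v\<in>V. u v) * (\<alpha> \<bullet> P x)"
    by (simp add: right_diff_distrib sum_subtractf inner_sum_right sum_distrib_right)
  also have "\<dots> = 0"
    using Px u(2) by simp
  finally have "(\<Sum>v\<in>V. u v * (\<alpha> \<bullet> P v - \<alpha> \<bullet> P x)) = 0" .
  then have "\<forall>v\<in>V. u v * (\<alpha> \<bullet> P v - \<alpha> \<bullet> P x) = 0"
    by (subst (asm) sum_nonneg_eq_0_iff) (use assms(1) min u(1) in auto)
  then have eq: "\<alpha> \<bullet> P v = \<alpha> \<bullet> P x" if "v \<in> V" "u v \<noteq> 0" for v
    using that by auto
  obtain v0 where v0: "v0 \<in> V" "u v0 \<noteq> 0"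
    using u(2) by (metis sum.neutral zero_neq_one)
  have "u v *\<^sub>R P v = u v *\<^sub>R P v0" if "v \<in> V" for v
    using gen[OF that v0(1)] eq[of v] eq[of v0] that v0 by (cases "u v = 0") auto
  then have "P x = (\<Sum>v\<in>V. u v *\<^sub>R P v0)"
    unfolding Px by (rule sum.cong[OF refl])
  also have "\<dots> = P v0"
    using u(2) by (simp flip: scaleR_sum_left)
  finally show ?thesis using v0 by blast
qed

section \<open>Optimal faces and their extreme points\<close>

lemma lp_argmin_eq_Int_hyperplane:
  assumes "x \<in> lp_argmin X c"
  shows "lp_argmin X c = X \<inter> {y. c \<bullet> y = c \<bullet> x}"
  using assms by (auto simp: lp_argmin_def is_arg_min_def intro: antisym simp: not_less)

lemma lp_argmin_face_of:
  assumes "convex X"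
  shows "lp_argmin X c face_of X"
proof (cases "lp_argmin X c = {}")
  case False
  then obtain x where x: "x \<in> lp_argmin X c" by blast
  then show ?thesis
    unfolding lp_argmin_eq_Int_hyperplane[OF x]
    by (intro face_of_Int_supporting_hyperplane_ge assms)
       (use x in \<open>auto simp: lp_argmin_def is_arg_min_def not_less\<close>)
qed simp

lemma polyhedron_polyhedron_eq: "polyhedron (polyhedron_eq A b)"
proof -
  have "polyhedron_eq A b =
      \<Inter> ((\<lambda>i. {x. row i A \<bullet> x = b $ i}) ` UNIV) \<inter> \<Inter> ((\<lambda>i. {x. axis i 1 \<bullet> x \<ge> 0}) ` UNIV)"
    by (auto simp: polyhedron_eq_def vec_eq_iff matrix_vector_mul_component inner_axis' row_def)
  then show ?thesis
    by (auto intro!: polyhedron_Int polyhedron_Inter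
        simp: polyhedron_hyperplane polyhedron_halfspace_ge)
qed

text \<open>Minkowski's theorem applies to each optimal face; extreme points of a face are extreme
  in \<open>X\<close>, and they are reachable for the same cost.\<close>

lemma reachable_solutions_subset_hull_extreme_points:
  fixes X :: "(real^'d) set"
  assumes "convex X" "compact X"
  shows "reachable_solutions X C \<subseteq>
    convex hull ({v. v extreme_point_of X} \<inter> reachable_solutions X C)"
proof
  fix x assume "x \<in> reachable_solutions X C"
  then obtain c where c: "c \<in> C" "x \<in> lp_argmin X c"
    by (auto simp: reachable_solutions_def)
  have face: "lp_argmin X c face_of X"
    by (rule lp_argmin_face_of[OF assms(1)])
  have "lp_argmin X c = convex hull {v. v extreme_point_of (lp_argmin X c)}"
    by (rule Krein_Milman_Minkowski[OF face_of_imp_compact[OF assms face] face_of_imp_convex[OF face]])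
  also have "\<dots> \<subseteq> convex hull ({v. v extreme_point_of X} \<inter> reachable_solutions X C)"
    using c(1) by (intro hull_mono) (auto simp: extreme_point_of_face[OF face] reachable_solutions_def)
  finally show "x \<in> convex hull ({v. v extreme_point_of X} \<inter> reachable_solutions X C)"
    using c(2) by blast
qed

section \<open>Linear programming duality\<close>

lemma inner_transpose_matrix: "(transpose A *v l) \<bullet> x = l \<bullet> (A *v (x::real^'d))"
  by (simp add: dot_lmul_matrix flip: vector_transpose_matrix)

text \<open>A Farkas argument at \<open>x\<close>: if \<open>c\<close> were outside the cone spanned
  by the rows of both signs and the unit vectors of the coordinates where \<open>x\<close> vanishes,
  a separating vector \<open>a\<close> would be a feasible direction at \<open>x\<close> along which
  the cost decreases.\<close>

lemma lp_dual_solution: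
  fixes A :: "real^'d^'m"
  assumes x: "x \<in> lp_argmin (polyhedron_eq A b) c"
  obtains l s where "\<And>i. 0 \<le> s $ i" "\<And>i. x $ i = 0 \<or> s $ i = 0" "transpose A *v l + s = c"
proof -
  define R where "R = range (\<lambda>j. row j A) \<union> range (\<lambda>j. - row j A) \<union>
      (\<lambda>i. axis i 1) ` {i. x $ i = 0}"
  \<comment> \<open>\<open>K\<close> holds the vectors with the desired decomposition. It is a
    convex cone containing \<open>R\<close>, so membership of \<open>c\<close> in the hull of
    \<open>R\<close> yields \<open>l\<close> and \<open>s\<close>.\<close>
  define K where "K = {transpose A *v l + s | l s.
      (\<forall>i. 0 \<le> s $ i) \<and> (\<forall>i. x $ i = 0 \<or> s $ i = 0)}"
  have x_feas: "A *v x = b" "\<And>i. 0 \<le> x $ i"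
    and x_min: "\<And>y. A *v y = b \<Longrightarrow> (\<And>i. 0 \<le> y $ i) \<Longrightarrow> c \<bullet> x \<le> c \<bullet> y"
    using x by (auto simp: lp_argmin_def is_arg_min_def polyhedron_eq_def not_less)
  have "c \<in> convex_cone hull R"
  proof (rule ccontr)
    assume notin: "c \<notin> convex_cone hull R"
    have "closed (convex_cone hull R)"
      by (rule closed_convex_cone_hull) (simp add: R_def)
    then obtain a t where a: "a \<bullet> c < t" "\<And>k. k \<in> convex_cone hull R \<Longrightarrow> a \<bullet> k > t"
      using separating_hyperplane_closed_point[OF convex_convex_cone_hull _ notin] by blast
    have "t < 0"
      using a(2)[OF convex_cone_hull_contains_0] by simp
    \<comment> \<open>Otherwise scaling \<open>k\<close> by the nonnegative factor
      \<open>t / (a \<bullet> k)\<close> gives a point of the cone with value exactly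
      \<open>t\<close>, which is not above \<open>t\<close>.\<close>
    have aR: "0 \<le> a \<bullet> k" if "k \<in> R" for k
    proof (rule ccontr)
      assume "\<not> 0 \<le> a \<bullet> k"
      then have "0 \<le> t / (a \<bullet> k)" "a \<bullet> ((t / (a \<bullet> k)) *\<^sub>R k) = t"
        using \<open>t < 0\<close> by (auto simp: divide_nonpos_nonpos)
      moreover from this have "(t / (a \<bullet> k)) *\<^sub>R k \<in> convex_cone hull R"
        using that by (intro convex_cone_hull_mul hull_inc) auto
      ultimately show False
        using a(2)[of "(t / (a \<bullet> k)) *\<^sub>R k"] by linarith
    qed
    have Aa: "A *v a = 0"
    proof -
      have "a \<bullet> row j A = 0" for j
        using aR[of "row j A"] aR[of "- row j A"] by (simp add: R_def)
      then have "A $ j \<bullet> a = 0" for j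
        by (simp add: row_def vec_lambda_eta inner_commute)
      then show ?thesis
        by (simp add: vec_eq_iff matrix_vector_mul_component)
    qed
    have a_nonneg: "0 \<le> a $ i" if "x $ i = 0" for i
      using aR[of "axis i 1"] that by (simp add: R_def inner_axis)
    \<comment> \<open>Bounds on the step length that keep \<open>x + e *\<^sub>R a\<close>
      nonnegative. Where \<open>x $ i = 0\<close> any positive value serves, as \<open>a $ i\<close>
      is nonnegative there; the added 1 keeps the denominator positive.\<close>
    define q where "q = (\<lambda>i. if x $ i = 0 then 1 else x $ i / (\<bar>a $ i\<bar> + 1))"
    define e where "e = Min (range q)"
    have "0 < q i" for i
      using x_feas(2)[of i] by (auto simp: q_def less_le intro!: divide_pos_pos)
    then have "0 < e"
      by (auto simp: e_def)
    have "0 \<le> (x + e *\<^sub>R a) $ i" for i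
    proof (cases "x $ i = 0")
      case True
      then show ?thesis
        using a_nonneg \<open>0 < e\<close> by simp
    next
      case False
      have "e \<le> x $ i / (\<bar>a $ i\<bar> + 1)"
        using Min_le[of "range q" "q i"] False by (simp add: e_def q_def)
      then have "e * (\<bar>a $ i\<bar> + 1) \<le> x $ i"
        by (simp add: pos_le_divide_eq)
      moreover have "e * - (a $ i) \<le> e * (\<bar>a $ i\<bar> + 1)"
        using \<open>0 < e\<close> by (intro mult_left_mono) auto
      ultimately show ?thesis by simp
    qed
    moreover have "A *v (x + e *\<^sub>R a) = b"
      using x_feas(1) Aa by (simp add: matrix_vector_right_distrib matrix_vector_mult_scaleR)
    ultimately have "c \<bullet> x \<le> c \<bullet> (x + e *\<^sub>R a)"
      using x_min by blast
    moreover have "e * (c \<bullet> a) < 0"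
      using a(1) \<open>t < 0\<close> \<open>0 < e\<close> by (intro mult_pos_neg) (auto simp: inner_commute)
    ultimately show False
      by (simp add: inner_add_right)
  qed
  also have "\<dots> \<subseteq> K"
  proof (rule hull_minimal)
    show "R \<subseteq> K"
    proof -
      have KI: "transpose A *v l + s \<in> K"
        if "\<And>i. 0 \<le> s $ i" "\<And>i. x $ i = 0 \<or> s $ i = 0" for l s
        using that by (auto simp: K_def)
      have row: "transpose A *v axis j 1 = row j A" "transpose A *v (- axis j 1) = - row j A" for j
        using matrix_vector_mult_scaleR[of "transpose A" "-1" "axis j 1"]
        by (simp_all add: matrix_vector_mult_basis column_transpose)
      have "row j A \<in> K" "- row j A \<in> K" for j
        using KI[of 0 "axis j 1"] KI[of 0 "- axis j 1"] by (simp_all only: row zero_index) simp_all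
      moreover have "axis i 1 \<in> K" if "x $ i = 0" for i
        using KI[of "axis i 1" 0] that by (auto simp: axis_def)
      ultimately show ?thesis
        unfolding R_def by auto
    qed
    show "convex_cone K"
      unfolding convex_cone_iff
    proof (intro conjI ballI allI impI)
      show "0 \<in> K"
        unfolding K_def by (rule CollectI, rule exI[of _ 0], rule exI[of _ 0]) simp
      fix k k' r
      assume "k \<in> K"
      then obtain l s where k: "k = transpose A *v l + s" "\<forall>i. 0 \<le> s $ i"
          "\<forall>i. x $ i = 0 \<or> s $ i = 0"
        by (auto simp: K_def)
      show "r *\<^sub>R k \<in> K" if "0 \<le> r"
        unfolding K_def
        by (rule CollectI, rule exI[of _ "r *\<^sub>R l"], rule exI[of _ "r *\<^sub>R s"])
           (use k that in \<open>auto simp: matrix_vector_mult_scaleR scaleR_add_right\<close>)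
      assume "k' \<in> K"
      then obtain l' s' where k': "k' = transpose A *v l' + s'" "\<forall>i. 0 \<le> s' $ i"
          "\<forall>i. x $ i = 0 \<or> s' $ i = 0"
        by (auto simp: K_def)
      show "k + k' \<in> K"
        unfolding K_def
        by (rule CollectI, rule exI[of _ "l + l'"], rule exI[of _ "s + s'"])
           (use k k' in \<open>fastforce simp: matrix_vector_right_distrib\<close>)
    qed
  qed
  finally show thesis
    using that by (auto simp: K_def)
qed

text \<open>The duality gap is \<open>s \<bullet> x\<close>; this serves both weak duality and
  complementary slackness.\<close>

lemma inner_dual_decomposition:
  fixes A :: "real^'d^'m"
  assumes "transpose A *v l + s = c" "A *v x = b"
  shows "c \<bullet> x = l \<bullet> b + s \<bullet> x"
  unfolding assms(1)[symmetric] assms(2)[symmetric] inner_add_left inner_transpose_matrix ..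

section \<open>The mixed-binary programs and complementary slackness\<close>

text \<open>\<open>tau $ i = 0\<close> forces \<open>x $ i = 0\<close>, and
  \<open>tau $ i = 1\<close> forces \<open>s $ i = 0\<close>. Hence the duality gap is zero and weak
  duality makes \<open>x\<close> optimal. This direction holds for every positive
  \<open>eps\<close>.\<close>

lemma prog_feasible_imp_reachable:
  fixes A :: "real^'d^'m"
  assumes "0 < eps" "prog_feasible A b C eps (x, l, s, c, tau)"
  shows "x \<in> reachable_solutions (polyhedron_eq A b) C"
proof -
  have f: "\<And>i. 0 \<le> x $ i" "\<And>i. 0 \<le> s $ i" "c \<in> C" "A *v x = b" "transpose A *v l + s = c"
    "\<And>i. tau $ i \<in> {0, 1}" "\<And>i. tau $ i \<le> 1 - eps * s $ i" "\<And>i. eps * x $ i \<le> tau $ i"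
    using assms(2) by (auto simp: prog_feasible_def)
  have "s $ i * x $ i = 0" for i
  proof (cases "tau $ i = 0")
    case True
    then show ?thesis
      using f(8)[of i] f(1)[of i] assms(1) by (simp add: mult_le_0_iff)
  next
    case False
    then have "tau $ i = 1" using f(6)[of i] by auto
    then show ?thesis
      using f(7)[of i] f(2)[of i] assms(1) by (simp add: mult_le_0_iff)
  qed
  then have "s \<bullet> x = 0"
    unfolding inner_vec_def by (intro sum.neutral) simp
  have "c \<bullet> x \<le> c \<bullet> y" if "A *v y = b" "\<forall>i. 0 \<le> y $ i" for y
  proof -
    have "0 \<le> s \<bullet> y"
      using that f(2) by (auto simp: inner_vec_def intro!: sum_nonneg)
    then show ?thesis
      using inner_dual_decomposition[OF f(5)] f(4) that \<open>s \<bullet> x = 0\<close> by simp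
  qed
  then have "x \<in> lp_argmin (polyhedron_eq A b) c"
    using f(1,4) by (fastforce simp: lp_argmin_def is_arg_min_def polyhedron_eq_def not_less)
  then show ?thesis
    using f(3) by (auto simp: reachable_solutions_def)
qed

text \<open>A dual solution found at one optimum serves the whole optimal face: equal costs give
  equal gaps, so \<open>s \<bullet> y = s \<bullet> x = 0\<close>, and all summands are
  nonnegative.\<close>

lemma lp_face_dual_solution:
  fixes A :: "real^'d^'m"
  assumes "x \<in> lp_argmin (polyhedron_eq A b) c"
  obtains l s where "\<And>i. 0 \<le> s $ i" "transpose A *v l + s = c"
    "\<And>y i. y \<in> lp_argmin (polyhedron_eq A b) c \<Longrightarrow> y $ i = 0 \<or> s $ i = 0"
proof -
  obtain l s where ls: "\<And>i. 0 \<le> s $ i" "\<And>i. x $ i = 0 \<or> s $ i = 0" "transpose A *v l + s = c"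
    using lp_dual_solution[OF assms] by blast
  have sx: "s \<bullet> x = 0"
    unfolding inner_vec_def by (intro sum.neutral) (use ls(2) in auto)
  have "y $ i = 0 \<or> s $ i = 0" if y: "y \<in> lp_argmin (polyhedron_eq A b) c" for y i
  proof -
    have feas: "A *v y = b" "A *v x = b" "\<And>i. 0 \<le> y $ i"
      using y assms by (auto simp: lp_argmin_def is_arg_min_def polyhedron_eq_def)
    have "c \<bullet> y = c \<bullet> x"
      using y lp_argmin_eq_Int_hyperplane[OF assms] by auto
    then have "s \<bullet> y = 0"
      using inner_dual_decomposition[OF ls(3)] feas sx by simp
    then have "\<forall>i\<in>UNIV. s $ i * y $ i = 0"
      unfolding inner_vec_def by (subst (asm) sum_nonneg_eq_0_iff) (use ls(1) feas in auto)
    then show ?thesis by auto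
  qed
  with ls that show thesis by blast
qed

text \<open>A polyhedron has finitely many faces, so finitely many dual slacks suffice for all costs
  in \<open>C\<close>, and one \<open>eps0\<close> works for all of them.\<close>

lemma fst_prog_feasible_eq_reachable:
  fixes A :: "real^'d^'m"
  assumes "bounded (polyhedron_eq A b)"
  obtains eps0 where "0 < eps0"
    "\<And>eps. 0 < eps \<Longrightarrow> eps < eps0 \<Longrightarrow>
      fst ` Collect (prog_feasible A b C eps) = reachable_solutions (polyhedron_eq A b) C"
proof -
  let ?X = "polyhedron_eq A b"
  define \<F> where "\<F> = lp_argmin ?X ` C - {{}}"
  have "finite \<F>"
    using lp_argmin_face_of[OF polyhedron_imp_convex[OF polyhedron_polyhedron_eq]]
    by (intro finite_subset[OF _ finite_polyhedron_faces[OF polyhedron_polyhedron_eq[of A b]]])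
       (auto simp: \<F>_def)
  have "\<forall>F\<in>\<F>. \<exists>s. \<exists>c\<in>C. \<exists>l. (\<forall>i. 0 \<le> s $ i) \<and> transpose A *v l + s = c \<and>
      (\<forall>y\<in>F. \<forall>i. y $ i = 0 \<or> s $ i = 0)"
  proof
    fix F assume "F \<in> \<F>"
    then obtain c x where c: "c \<in> C" "F = lp_argmin ?X c" "x \<in> lp_argmin ?X c"
      by (auto simp: \<F>_def)
    show "\<exists>s. \<exists>c\<in>C. \<exists>l. (\<forall>i. 0 \<le> s $ i) \<and> transpose A *v l + s = c \<and>
        (\<forall>y\<in>F. \<forall>i. y $ i = 0 \<or> s $ i = 0)"
      using lp_face_dual_solution[OF c(3)] c(1,2) by metis
  qed
  then obtain \<sigma> where \<sigma>: "\<And>F. F \<in> \<F> \<Longrightarrow> \<exists>c\<in>C. \<exists>l. (\<forall>i. 0 \<le> \<sigma> F $ i) \<and>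
      transpose A *v l + \<sigma> F = c \<and> (\<forall>y\<in>F. \<forall>i. y $ i = 0 \<or> \<sigma> F $ i = 0)"
    by metis
  \<comment> \<open>The constraints multiply the entries of both \<open>x\<close> and
    \<open>s\<close> by \<open>eps\<close>, so one bound \<open>M\<close> has to cover both.\<close>
  have "bounded (?X \<union> \<sigma> ` \<F>)"
    using assms \<open>finite \<F>\<close> by (simp add: finite_imp_bounded)
  then obtain M where M: "0 < M" "\<And>z. z \<in> ?X \<union> \<sigma> ` \<F> \<Longrightarrow> norm z \<le> M"
    by (auto simp: bounded_pos)
  show thesis
  proof (rule that[of "1 / M"])
    show "0 < 1 / M" using M by simp
    fix eps :: real assume eps: "0 < eps" "eps < 1 / M"
    have small: "eps * z $ i \<le> 1" if "z \<in> ?X \<union> \<sigma> ` \<F>" for z i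
    proof -
      have "z $ i \<le> M"
        using M(2)[OF that] component_le_norm_cart[of z i] by linarith
      then have "eps * z $ i \<le> eps * M"
        using eps by simp
      also have "\<dots> \<le> 1"
        using eps M(1) by (simp add: pos_less_divide_eq)
      finally show ?thesis .
    qed
    show "fst ` Collect (prog_feasible A b C eps) = reachable_solutions ?X C"
    proof (intro equalityI subsetI)
      fix x assume "x \<in> fst ` Collect (prog_feasible A b C eps)"
      then show "x \<in> reachable_solutions ?X C"
        using prog_feasible_imp_reachable[OF eps(1)] by fastforce
    next
      fix x assume "x \<in> reachable_solutions ?X C"
      then obtain F where F: "F \<in> \<F>" "x \<in> F"
        by (auto simp: reachable_solutions_def \<F>_def)
      then have xX: "x \<in> ?X"
        by (auto simp: \<F>_def lp_argmin_def is_arg_min_def)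
      \<comment> \<open>This \<open>c\<close> is the cost chosen for the face \<open>F\<close>; it
        may differ from the cost that made \<open>x\<close> reachable.\<close>
      obtain c l where cl: "c \<in> C" "\<forall>i. 0 \<le> \<sigma> F $ i" "transpose A *v l + \<sigma> F = c"
          "\<forall>i. x $ i = 0 \<or> \<sigma> F $ i = 0"
        using \<sigma>[OF F(1)] F(2) by blast
      define tau :: "real^'d" where "tau = (\<chi> i. if x $ i = 0 then 0 else 1)"
      have "prog_feasible A b C eps (x, l, \<sigma> F, c, tau)"
        unfolding prog_feasible_def
        using xX cl small[of x] small[of "\<sigma> F"] F(1) by (auto simp: polyhedron_eq_def tau_def)
      then show "x \<in> fst ` Collect (prog_feasible A b C eps)"
        by force
    qed
  qed
qed

section \<open>One pass through the loop, and the stopping test\<close>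

text \<open>A nonzero value means that \<open>fst v - x0\<close> has a nonzero projection, hence is
  a new direction. It need not lie in \<open>T\<close>, but by genericity the optimum has the same
  projection as some \<open>w\<close> in \<open>V\<close>, so modulo \<open>span D\<close> it can be
  replaced by \<open>w - x0\<close>.\<close>

lemma improving_solution_generic:
  fixes A :: "real^'d^'m"
  assumes feas: "fst ` Collect (prog_feasible A b C eps) = S"
    and V: "finite V" "x0 \<in> V" "V \<subseteq> S" "S \<subseteq> convex hull V"
    and T: "T = {v - w | v w. v \<in> V \<and> w \<in> V}"
    and gen: "generic_for T \<alpha>" and B: "B \<subseteq> T" "span D = span B"
    and imp: "improving_solution A b C eps x0 \<alpha> D v"
  shows "fst v \<in> S" "fst v - x0 \<notin> span D" "\<exists>d\<in>T. span (insert (fst v - x0) D) = span (insert d B)"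
proof -
  define P where "P = orth_proj (orthogonal_comp (span D))"
  define y where "y = fst v"
  have linP: "linear P"
    unfolding P_def by (intro linear_orth_proj subspace_orthogonal_comp)
  have P0: "P z = 0 \<longleftrightarrow> z \<in> span D" for z
    unfolding P_def by (intro orth_proj_orthogonal_comp_eq_0_iff) simp
  have obj: "prog_objective x0 \<alpha> D w = \<alpha> \<bullet> P x0 - \<alpha> \<bullet> P (fst w)" for w :: "('d, 'm) prog_vars"
    by (cases w) (simp add: prog_objective_def linear_diff[OF linP] inner_diff_right flip: P_def)
  show "fst v \<in> S"
    using imp feas by (auto simp: improving_solution_def is_arg_min_def is_arg_max_def)
  have "P x0 \<noteq> P y"
    using imp obj[of v] by (auto simp: improving_solution_def y_def)
  then show "fst v - x0 \<notin> span D"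
    using P0[of "y - x0"] by (simp add: y_def linear_diff[OF linP])
  \<comment> \<open>The objective contains \<open>x0 - x\<close>, so its minimizers maximize
    \<open>\<alpha> \<bullet> P z\<close>, and its maximizers minimize it.\<close>
  have "(\<forall>z\<in>S. \<alpha> \<bullet> P z \<le> \<alpha> \<bullet> P y) \<or> (\<forall>z\<in>S. \<alpha> \<bullet> P y \<le> \<alpha> \<bullet> P z)"
  proof -
    from imp consider "is_arg_min (prog_objective x0 \<alpha> D) (prog_feasible A b C eps) v"
      | "is_arg_max (prog_objective x0 \<alpha> D) (prog_feasible A b C eps) v"
      by (auto simp: improving_solution_def)
    then show ?thesis
    proof cases
      case 1
      then show ?thesis
        by (intro disjI1) (force simp: is_arg_min_def obj not_less y_def simp flip: feas)
    next
      case 2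
      then show ?thesis
        by (intro disjI2) (force simp: is_arg_max_def obj not_less y_def simp flip: feas)
    qed
  qed
  \<comment> \<open>A change of sign turns both cases into a minimization.\<close>
  then obtain \<beta> where \<beta>: "\<beta> = \<alpha> \<or> \<beta> = - \<alpha>" "\<And>z. z \<in> S \<Longrightarrow> \<beta> \<bullet> P y \<le> \<beta> \<bullet> P z"
    by (metis inner_minus_left neg_le_iff_le)
  have "P w = P w'" if "w \<in> V" "w' \<in> V" "\<beta> \<bullet> P w = \<beta> \<bullet> P w'" for w w'
  proof -
    have "\<alpha> \<bullet> P (w - w') = 0"
      using that(3) \<beta>(1) by (auto simp: linear_diff[OF linP] inner_diff_right)
    then have "w - w' \<in> span D"
      using gen that(1,2) B unfolding generic_for_def T P_def by auto
    then show ?thesis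
      using P0[of "w - w'"] by (simp add: linear_diff[OF linP])
  qed
  then obtain w where w: "w \<in> V" "P y = P w"
    using minimizer_over_hull_same_image[OF V(1) _ linP, of y \<beta>] \<beta>(2) V \<open>fst v \<in> S\<close>
    unfolding y_def by blast
  have "(y - x0) - (w - x0) \<in> span D"
    using w(2) P0[of "y - w"] by (simp add: linear_diff[OF linP])
  then have "span (insert (y - x0) D) = span (insert (w - x0) D)"
    by (rule eq_span_insert_eq)
  also have "\<dots> = span (insert (w - x0) B)"
    using B(2) by (simp add: span_insert)
  finally show "\<exists>d\<in>T. span (insert (fst v - x0) D) = span (insert d B)"
    using w(1) V(2) by (auto simp: y_def T)
qed

lemma linear_bounded_on_hull:
  fixes f :: "'a::real_vector \<Rightarrow> real"
  assumes "linear f" "\<And>v. v \<in> V \<Longrightarrow> f v \<le> m" "z \<in> convex hull V"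
  shows "f z \<le> m"
proof -
  have "convex (f -` {..m})"
    using assms(1) by (intro convex_linear_vimage) auto
  then have "convex hull V \<subseteq> f -` {..m}"
    using assms(2) by (intro hull_minimal) auto
  then show ?thesis using assms(3) by auto
qed

text \<open>Both programs attain their optima at points of the finite set \<open>V\<close>. If both
  values are zero, \<open>f\<close> is constant on \<open>V\<close>, and genericity puts every
  \<open>v - x0\<close> into \<open>span D\<close>.\<close>

lemma not_improving_imp_spanning:
  fixes A :: "real^'d^'m"
  assumes feas: "fst ` Collect (prog_feasible A b C eps) = S"
    and V: "finite V" "x0 \<in> V" "V \<subseteq> S" "S \<subseteq> convex hull V"
    and T: "T = {v - w | v w. v \<in> V \<and> w \<in> V}"
    and gen: "generic_for T \<alpha>" and B: "B \<subseteq> T" "span D = span B"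
    and imp: "\<nexists>v. improving_solution A b C eps x0 \<alpha> D v"
    and y: "y \<in> S"
  shows "y - x0 \<in> span D"
proof -
  define P where "P = orth_proj (orthogonal_comp (span D))"
  have linP: "linear P"
    unfolding P_def by (intro linear_orth_proj subspace_orthogonal_comp)
  define f where "f = (\<lambda>z. \<alpha> \<bullet> P z)"
  have linf: "linear f" "linear (\<lambda>z. - f z)"
    using linP unfolding f_def
    by (auto intro!: linearI simp: linear_add linear_scale inner_add_right)
  have obj: "prog_objective x0 \<alpha> D w = f x0 - f (fst w)" for w :: "('d, 'm) prog_vars"
    by (cases w) (simp add: prog_objective_def f_def linear_diff[OF linP] inner_diff_right flip: P_def)
  have lift: "\<exists>w. prog_feasible A b C eps w \<and> fst w = z" if "z \<in> V" for z
    using V(3) feas that by blast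
  have hull: "fst w \<in> convex hull V" if "prog_feasible A b C eps w" for w
    using V(4) feas that by blast
  have fV: "f v = f x0" if v: "v \<in> V" for v
  proof (rule antisym)
    define m where "m = Max (f ` V)"
    have "m \<in> f ` V"
      unfolding m_def using V by (intro Max_in) auto
    then obtain w where w: "prog_feasible A b C eps w" "f (fst w) = m"
      using lift by force
    have "f z \<le> m" if "z \<in> convex hull V" for z
      by (rule linear_bounded_on_hull[OF linf(1) _ that]) (use V(1) in \<open>auto simp: m_def\<close>)
    \<comment> \<open>All feasible \<open>x\<close> lie in the hull of \<open>V\<close>, so the
      largest value of \<open>f\<close> on \<open>V\<close> gives the smallest objective.\<close>
    then have "is_arg_min (prog_objective x0 \<alpha> D) (prog_feasible A b C eps) w"
      using w hull by (auto simp: is_arg_min_def obj not_less)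
    then have "prog_objective x0 \<alpha> D w = 0"
      using imp unfolding improving_solution_def by blast
    then have "m = f x0"
      using w(2) by (simp add: obj)
    then show "f v \<le> f x0"
      using V(1) v by (metis Max_ge finite_imageI imageI m_def)
  next
    define m where "m = Min (f ` V)"
    have "m \<in> f ` V"
      unfolding m_def using V by (intro Min_in) auto
    then obtain w where w: "prog_feasible A b C eps w" "f (fst w) = m"
      using lift by force
    have "- f z \<le> - m" if "z \<in> convex hull V" for z
      by (rule linear_bounded_on_hull[OF linf(2) _ that]) (use V(1) in \<open>auto simp: m_def\<close>)
    then have "is_arg_max (prog_objective x0 \<alpha> D) (prog_feasible A b C eps) w"
      using w hull by (auto simp: is_arg_max_def obj not_less)
    then have "prog_objective x0 \<alpha> D w = 0"
      using imp unfolding improving_solution_def by blast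
    then have "m = f x0"
      using w(2) by (simp add: obj)
    then show "f x0 \<le> f v"
      using V(1) v by (metis Min_le finite_imageI imageI m_def)
  qed
  have "v - x0 \<in> span D" if "v \<in> V" for v
  proof -
    have "\<alpha> \<bullet> P (v - x0) = 0"
      using fV[OF that] by (simp add: f_def linear_diff[OF linP] inner_diff_right)
    then show ?thesis
      using gen that V(2) B unfolding generic_for_def T P_def by auto
  qed
  \<comment> \<open>The translate of \<open>span D\<close> by \<open>x0\<close> is convex, so it
    contains the hull of \<open>V\<close> and with it \<open>S\<close>.\<close>
  then have "V \<subseteq> (+) x0 ` span D"
    by (auto intro!: image_eqI[of _ _ "_ - x0"])
  then have "convex hull V \<subseteq> (+) x0 ` span D"
    by (intro hull_minimal convex_translation subspace_imp_convex) auto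
  then show ?thesis
    using y V(4) by auto
qed

section \<open>The loop invariant and the theorem\<close>

text \<open>Induction over the passes. The elements of \<open>D\<close> may be arbitrary optima, so
  only the span of \<open>D\<close>, not \<open>D\<close> itself, is tied to the finite set
  \<open>T\<close>; this is what lets genericity apply to the next sample.\<close>

lemma after_steps_generic:
  fixes A :: "real^'d^'m"
  assumes feas: "fst ` Collect (prog_feasible A b C eps) = S"
    and V: "finite V" "x0 \<in> V" "V \<subseteq> S" "S \<subseteq> convex hull V"
    and T: "T = {v - w | v w. v \<in> V \<and> w \<in> V}"
    and gen: "\<And>k. generic_for T (a k)"
    and "after_steps A b C eps x0 a n D"
  shows "independent D \<and> finite D \<and> card D = n \<and> D \<subseteq> (\<lambda>y. y - x0) ` S \<and>
    (\<exists>B\<subseteq>T. span D = span B)"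
  using assms(8)
proof induction
  case init
  then show ?case by (auto simp: independent_empty)
next
  case (step k D D')
  then obtain v B where v: "improving_solution A b C eps x0 (a k) D v"
      "D' = insert (fst v - x0) D" and B: "B \<subseteq> T" "span D = span B"
    by (auto simp: loop_step_def)
  note imp = improving_solution_generic[OF feas V T gen B v(1)]
  have "fst v - x0 \<notin> D"
    using imp(2) span_base by blast
  moreover obtain d where "d \<in> T" "span D' = span (insert d B)"
    using imp(3) v(2) by blast
  then have "\<exists>B\<subseteq>T. span D' = span B"
    using B(1) by (intro exI[of _ "insert d B"]) auto
  ultimately show ?case
    using step.IH imp(1) v(2) independent_insertI[OF imp(2)] by auto
qed

lemma runs_forever_after_steps:
  assumes "runs_forever A b C eps x0 a Ds"
  shows "after_steps A b C eps x0 a k (Ds k)"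
proof (induction k)
  case 0
  then show ?case
    using assms by (simp add: runs_forever_def after_steps.init)
next
  case (Suc k)
  then show ?case
    using assms by (auto simp: runs_forever_def intro: after_steps.step)
qed

lemma dir_eq_span:
  assumes "x0 \<in> S"
  shows "dir S = span ((\<lambda>y. y - x0) ` S)"
  unfolding dir_def
proof (rule span_eq[THEN iffD2], intro conjI subsetI)
  fix z assume "z \<in> {x - y | x y. x \<in> S \<and> y \<in> S}"
  then obtain x y where "z = (x - x0) - (y - x0)" "x \<in> S" "y \<in> S"
    by auto
  then show "z \<in> span ((\<lambda>y. y - x0) ` S)"
    by (metis imageI span_base span_diff)
qed (use assms in \<open>auto intro: span_base\<close>)

theorem theorem3:
  fixes A :: "real^'d^'m" and b :: "real^'m" and C :: "(real^'d) set"
  assumes "bounded (polyhedron_eq A b)"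
    and "polyhedron_eq A b \<noteq> {}"
    and "C \<noteq> {}"
  shows "dim (dir (reachable_solutions (polyhedron_eq A b) C)) \<le> CARD('d) \<and>
    (\<exists>eps0>0. \<forall>eps. 0 < eps \<and> eps < eps0 \<longrightarrow>
      (\<forall>c0\<in>C. \<forall>x0\<in>lp_argmin (polyhedron_eq A b) c0.
        AE a in (\<Pi>\<^sub>M k\<in>(UNIV::nat set). (std_gaussian :: (real^'d) measure)).
          (\<nexists>Ds. runs_forever A b C eps x0 a Ds) \<and>
          (\<forall>n D. returns_after A b C eps x0 a n D \<longrightarrow>
             n = dim (dir (reachable_solutions (polyhedron_eq A b) C)) \<and>
             is_basis_of D (dir (reachable_solutions (polyhedron_eq A b) C)))))"
proof -
  let ?X = "polyhedron_eq A b"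
  define S where "S = reachable_solutions ?X C"
  have X: "convex ?X" "compact ?X"
    using polyhedron_polyhedron_eq[of A b] assms(1)
    by (auto simp: compact_eq_bounded_closed polyhedron_imp_closed polyhedron_imp_convex)
  \<comment> \<open>\<open>eps0\<close> is fixed before \<open>c0\<close> and \<open>x0\<close>;
    only the exceptional null set may depend on them.\<close>
  obtain eps0 where eps0: "0 < eps0" "\<And>eps. 0 < eps \<Longrightarrow> eps < eps0 \<Longrightarrow>
      fst ` Collect (prog_feasible A b C eps) = S"
    using fst_prog_feasible_eq_reachable[OF assms(1)] unfolding S_def by metis
  have "AE a in (\<Pi>\<^sub>M k\<in>(UNIV::nat set). (std_gaussian :: (real^'d) measure)).
      (\<nexists>Ds. runs_forever A b C eps x0 a Ds) \<and>
      (\<forall>n D. returns_after A b C eps x0 a n D \<longrightarrow> n = dim (dir S) \<and> is_basis_of D (dir S))"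
    if eps: "0 < eps" "eps < eps0" and "c0 \<in> C" "x0 \<in> lp_argmin ?X c0" for eps c0 x0
  proof -
    note feas = eps0(2)[OF eps]
    have "x0 \<in> S"
      using that by (auto simp: S_def reachable_solutions_def)
    \<comment> \<open>\<open>x0\<close> is added because an optimal starting point need not be
      extreme.\<close>
    define V where "V = insert x0 ({v. v extreme_point_of ?X} \<inter> S)"
    define T where "T = {v - w | v w. v \<in> V \<and> w \<in> V}"
    have "S \<subseteq> convex hull ({v. v extreme_point_of ?X} \<inter> S)"
      unfolding S_def by (rule reachable_solutions_subset_hull_extreme_points[OF X])
    also have "\<dots> \<subseteq> convex hull V"
      unfolding V_def by (intro hull_mono) auto
    finally have V: "finite V" "x0 \<in> V" "V \<subseteq> S" "S \<subseteq> convex hull V"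
      using \<open>x0 \<in> S\<close> finite_polyhedron_extreme_points[OF polyhedron_polyhedron_eq[of A b]]
      by (auto simp: V_def)
    have "finite T"
      unfolding T_def by (rule finite_image_set2) (use V(1) in simp_all)
    then have "AE a in (\<Pi>\<^sub>M k\<in>(UNIV::nat set). (std_gaussian :: (real^'d) measure)).
        \<forall>k. generic_for T (a k)"
      by (intro AE_all_countable[THEN iffD2] allI AE_PiM_component prob_space_std_gaussian
          AE_generic_for) auto
    then show ?thesis
    proof (rule eventually_mono)
      fix a :: "nat \<Rightarrow> real^'d" assume "\<forall>k. generic_for T (a k)"
      then have gen: "generic_for T (a k)" for k by blast
      note inv = after_steps_generic[OF feas V T_def gen]
      have "\<nexists>Ds. runs_forever A b C eps x0 a Ds"
      proof
        assume "\<exists>Ds. runs_forever A b C eps x0 a Ds"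
        then obtain Ds where "runs_forever A b C eps x0 a Ds" ..
        \<comment> \<open>One pass more than the dimension would give too many independent
          vectors.\<close>
        from inv[OF runs_forever_after_steps[OF this, of "Suc CARD('d)"]]
        show False
          using independent_bound[of "Ds (Suc CARD('d))"] by simp
      qed
      moreover have "n = dim (dir S) \<and> is_basis_of D (dir S)"
        if "returns_after A b C eps x0 a n D" for n D
      proof -
        from that have D: "after_steps A b C eps x0 a n D"
            "\<nexists>v. improving_solution A b C eps x0 (a n) D v"
          by (auto simp: returns_after_def)
        obtain B where B: "B \<subseteq> T" "span D = span B"
          using inv[OF D(1)] by blast
        have "(\<lambda>y. y - x0) ` S \<subseteq> span D"
          using not_improving_imp_spanning[OF feas V T_def gen B D(2)] by blast
        moreover have "D \<subseteq> span ((\<lambda>y. y - x0) ` S)"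
          using inv[OF D(1)] by (auto intro: span_base)
        ultimately have "span D = dir S"
          unfolding dir_eq_span[OF \<open>x0 \<in> S\<close>] by (simp add: span_eq)
        then show ?thesis
          using inv[OF D(1)] by (auto simp: is_basis_of_def dim_span dim_eq_card_independent
              simp flip: \<open>span D = dir S\<close>)
      qed
      ultimately show "(\<nexists>Ds. runs_forever A b C eps x0 a Ds) \<and>
          (\<forall>n D. returns_after A b C eps x0 a n D \<longrightarrow> n = dim (dir S) \<and> is_basis_of D (dir S))"
        by blast
    qed
  qed
  moreover have "dim (dir S) \<le> CARD('d)"
    using dim_subset_UNIV[of "dir S"] by simp
  ultimately show ?thesis
    using eps0(1) unfolding S_def by blast
qed

end
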